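(* There does not exist any $(4,4)$-net in the complex projective plane $\mathbb{C}P^2$.
   Context: Let $k>1$ be an integer. For each $i\in\{1,\dots,k\}$ let $\mathcal{A}_i$ be a finite set of lines in $\mathbb{C}P^2$, and let $\mathcal{X}$ be a finite set of points of $\mathbb{C}P^2$. The collection $(\mathcal{A}_1,\dots,\mathcal{A}_k,\mathcal{X})$ is called a $k$-net in $\mathbb{C}P^2$ if: (1) $\mathcal{A}_i$ and $\mathcal{A}_j$ are disjoint whenever $i\neq j$; (2) if $i\neq j$, $\ell\in\mathcal{A}_i$ and $m\in\mathcal{A}_j$, then the intersection point $\ell\cap m$ belongs to $\mathcal{X}$; (3) for every $p\in\mathcal{X}$ and every $i\in\{1,\dots,k\}$ there is a unique $\ell\in\mathcal{A}_i$ with $p\in\ell$. A $(k,d)$-net is a $k$-net in which $|\mathcal{A}_i|=d$ for all $i$ (and $|\mathcal{X}|=d^2$). *)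

theory Defs
  imports "HOL-Analysis.Analysis"
begin

text \<open>
  Points of the complex projective plane are the one-dimensional complex subspaces of
  \<open>complex ^ 3\<close>. A line is the set of all points contained in some two-dimensional complex subspace.
  Here \<open>vec\<close> is the library's vector space structure over the scalar field
  (scalar multiplication \<open>(*s)\<close>), so subspaces and dimensions are complex, whereas the plain
  constants \<open>subspace\<close> and \<open>dim\<close> would be the real ones.
\<close>

type_synonym proj_point = "(complex ^ 3) set"

definition CP2 :: "proj_point set" where
  "CP2 = {p. vec.subspace p \<and> vec.dim p = 1}"

definition CP2_lines :: "proj_point set set" where
  "CP2_lines = {{p \<in> CP2. p \<subseteq> W} | W. vec.subspace W \<and> vec.dim W = 2}"

text \<open>
  The classes of a \<open>k\<close>-net are \<open>A 1, \<dots>, A k\<close>; values of \<open>A\<close> at other indices are irrelevant.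
\<close>

definition is_net :: "nat \<Rightarrow> (nat \<Rightarrow> proj_point set set) \<Rightarrow> proj_point set \<Rightarrow> bool" where
  "is_net k A X \<longleftrightarrow>
     k > 1 \<and>
     (\<forall>i\<in>{1..k}. finite (A i) \<and> A i \<subseteq> CP2_lines) \<and>
     finite X \<and> X \<subseteq> CP2 \<and>
     (\<forall>i\<in>{1..k}. \<forall>j\<in>{1..k}. i \<noteq> j \<longrightarrow> A i \<inter> A j = {}) \<and>
     (\<forall>i\<in>{1..k}. \<forall>j\<in>{1..k}. i \<noteq> j \<longrightarrow>
        (\<forall>l\<in>A i. \<forall>m\<in>A j. \<exists>p\<in>X. l \<inter> m = {p})) \<and>
     (\<forall>p\<in>X. \<forall>i\<in>{1..k}. \<exists>!l. l \<in> A i \<and> p \<in> l)"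

definition is_kd_net ::
    "nat \<Rightarrow> nat \<Rightarrow> (nat \<Rightarrow> proj_point set set) \<Rightarrow> proj_point set \<Rightarrow> bool" where
  "is_kd_net k d A X \<longleftrightarrow>
     is_net k A X \<and> (\<forall>i\<in>{1..k}. card (A i) = d) \<and> card X = d\<^sup>2"

end

theory Submission
  imports Defs
begin

text \<open>
  Choose a linear form for every line and a vector for every point. At a point \<open>p\<close> of \<open>X\<close> the forms
  \<open>L, M, N, K\<close> of the four lines through \<open>p\<close> lie in a two-dimensional space, so
  \<open>N = \<mu> L + \<nu> M\<close> and \<open>K\<close> is proportional to \<open>\<mu> L + \<kappa> \<nu> M\<close>, where \<open>\<kappa>\<close> is the cross ratio of the four lines.

  The first idea is that \<open>\<kappa>\<close> is the same at all points of \<open>X\<close> (\<open>cross_ratio_const\<close>). The usual reason is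
  that the products of the forms of the classes lie in one pencil of curves, two of them
  generating it. This can be seen without polynomials: on a line \<open>l\<close> of the
  first class, \<open>\<Prod>N\<close> equals \<open>\<Prod>M\<close> times the product of the \<open>\<nu>(p)\<close> with \<open>p\<close> on \<open>l\<close>; comparing two lines
  at their intersection shows that this factor does not depend on \<open>l\<close> (\<open>restriction_product_const\<close>).
  It expresses \<open>\<nu>(p)\<close> through the values at \<open>p\<close> of the lines that do not pass through \<open>p\<close>, and the same
  holds for the other coefficients; those values cancel in \<open>\<kappa>\<close>.

  The second idea is combinatorial: a net with four classes of four lines is an affine plane of order
  four without one of its five parallel classes, so it has the Fano property: if one diagonal of a
  parallelogram lies on a line of the third class, so does the other one (\<open>parallelogram\<close>).

  Together they finish the proof. Let \<open>p, q, r, s\<close> be a parallelogram with both diagonals in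
  the third class. The lines of the fourth class through its vertices are four different
  lines, hence all of the fourth class. After rescaling, their forms satisfy
  \<open>u\<^sub>p + u\<^sub>q + u\<^sub>r + u\<^sub>s = 0\<close>, and this is their only linear relation. Constancy of \<open>\<kappa>\<close> makes the
  side \<open>L\<close> through \<open>p\<close> and \<open>q\<close> a combination of \<open>u\<^sub>p + u\<^sub>r\<close> and \<open>u\<^sub>p + u\<^sub>s\<close> (\<open>quadrangle_algebra\<close>). That means that
  \<open>L\<close> passes through the diagonal point of the four lines that belongs to the partition \<open>{p, q}, {r, s}\<close>.
  Another parallelogram at \<open>p\<close> with the same side \<open>L\<close> gives a different partition, so \<open>L\<close> passes
  through a second diagonal point. The line through two diagonal points is \<open>u\<^sub>p + u\<^sub>d = 0\<close> for a
  line \<open>d\<close> of the fourth class other than \<open>u\<^sub>p = 0\<close>. As \<open>L\<close> and \<open>u\<^sub>p\<close> vanish at \<open>p\<close>, so does \<open>d\<close>: two lines of one class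
  through a point of \<open>X\<close>, a contradiction.
\<close>

section \<open>Linear forms for the lines of the plane\<close>

text \<open>
  The pairing is bilinear rather than Hermitian, so that forms and points are treated alike and each
  statement about forms can be dualised.
\<close>

definition ev :: "complex ^ 3 \<Rightarrow> complex ^ 3 \<Rightarrow> complex" where
  "ev f v = (\<Sum>i\<in>UNIV. f $ i * v $ i)"

lemma ev_simps [simp]:
  "ev (f + g) v = ev f v + ev g v"
  "ev (c *s f) v = c * ev f v" "ev f (c *s v) = c * ev f v"
  "ev 0 v = 0" "ev f 0 = 0"
  by (simp_all add: ev_def algebra_simps sum.distrib sum_distrib_left)

lemma ev_add_right: "ev f (u + v) = ev f u + ev f v"
  by (simp add: ev_def algebra_simps sum.distrib)

lemma ev_commute: "ev f v = ev v f"
  by (simp add: ev_def mult.commute)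

lemma ev_nondegenerate:
  assumes "f \<noteq> 0" obtains v where "ev f v \<noteq> 0"
proof -
  obtain i where "f $ i \<noteq> 0" using assms by (auto simp: vec_eq_iff)
  moreover have "ev f (axis i 1) = f $ i"
    by (simp add: ev_def axis_def if_distrib[of "\<lambda>x. _ * x"] cong: if_cong)
  ultimately show thesis using that by metis
qed

lemma ex_common_zero: obtains v where "v \<noteq> 0" "ev f v = 0" "ev g v = 0"
proof -
  \<comment> \<open>The zero row makes the matrix singular; a vector of its kernel is a common zero.\<close>
  define M :: "complex ^ 3 ^ 3" where "M = (\<chi> i. if i = 1 then f else if i = 2 then g else 0)"
  have "M $ 3 = 0" by (simp add: M_def)
  then have "det M = 0" by (intro det_zero_row[of 3]) (simp_all add: row_def vec_eq_iff)
  then have "\<not> (\<exists>B. B ** M = mat 1)" using invertible_det_nz invertible_left_inverse by metis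
  then obtain v where v: "v \<noteq> 0" "M *v v = 0" using matrix_left_invertible_ker by metis
  have "ev (M $ i) v = 0" for i
    using v(2) by (simp add: vec_eq_iff matrix_vector_mult_def ev_def)
  from this[of 1] this[of 2] show thesis using v(1) that by (simp add: M_def)
qed

lemma subspace_zeros: "vec.subspace {v. ev f v = 0}"
  by (rule vec.subspaceI) (simp_all add: ev_add_right)

lemma dim_zeros: assumes "f \<noteq> 0" shows "vec.dim {v. ev f v = 0} \<le> 2"
proof (rule ccontr)
  assume "\<not> ?thesis"
  then have "vec.dim {v. ev f v = 0} \<ge> vec.dim (UNIV :: (complex ^ 3) set)"
    by (simp only: vec_dim_card) simp
  then have "{v. ev f v = 0} = UNIV"
    by (intro vec.subspace_dim_equal subspace_zeros vec.subspace_UNIV) auto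
  with assms show False by (metis UNIV_I ev_nondegenerate mem_Collect_eq)
qed

lemma plane_form:
  assumes W: "vec.subspace W" "vec.dim W = 2"
  obtains f where "f \<noteq> 0" "W = {v. ev f v = 0}"
proof -
  obtain B where B: "finite B" "vec.span B = W" "card B = 2"
    using vec.basis_subspace_exists[OF W(1)] W(2) by metis
  then obtain u v where uv: "B = {u, v}" by (meson card_2_iff)
  obtain f where f: "f \<noteq> 0" "ev u f = 0" "ev v f = 0" using ex_common_zero by blast
  have "W \<subseteq> {v. ev f v = 0}"
    unfolding B(2)[symmetric] uv
    using f by (intro vec.span_minimal subspace_zeros) (auto simp: ev_commute)
  moreover have "vec.dim {v. ev f v = 0} \<le> vec.dim W" using dim_zeros[OF f(1)] W by simp
  ultimately have "W = {v. ev f v = 0}"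
    by (intro vec.subspace_dim_equal W(1) subspace_zeros)
  with f(1) that show thesis by blast
qed

text \<open>
  The forms vanishing at \<open>p\<close> are a plane in the dual space, by duality with \<open>dim_zeros\<close>, so two
  independent ones span it.
\<close>

lemma in_pencil:
  assumes "p \<noteq> 0" "ev f p = 0" "ev g p = 0" "ev h p = 0" "g \<noteq> 0" "\<And>c. f \<noteq> c *s g"
  obtains a b where "h = a *s f + b *s g"
proof -
  let ?Z = "{v. ev p v = 0}"
  have "vec.independent {f, g}"
    using assms(5,6) by (auto simp: vec.independent_insert vec.span_singleton)
  moreover have "f \<noteq> g" using assms(6)[of 1] by auto
  ultimately have "vec.dim (vec.span {f, g}) = 2"
    by (subst vec.dim_span_eq_card_independent) auto
  moreover have "vec.span {f, g} \<subseteq> ?Z"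
    using assms(2,3) by (intro vec.span_minimal subspace_zeros) (auto simp: ev_commute)
  ultimately have "vec.span {f, g} = ?Z"
    using dim_zeros[OF assms(1)] by (intro vec.subspace_dim_equal subspace_zeros) auto
  then have "h \<in> vec.span {f, g}" using assms(4) by (simp add: ev_commute)
  then obtain a b where "h - a *s f = b *s g"
    by (auto simp: vec.span_breakdown_eq vec.span_singleton)
  then have "h = a *s f + b *s g" by (simp add: diff_eq_eq add.commute)
  then show thesis by (rule that)
qed

lemma CP2_line_form:
  assumes "l \<in> CP2_lines"
  obtains f where "f \<noteq> 0" "l = {p \<in> CP2. \<forall>v\<in>p. ev f v = 0}"
proof -
  obtain W where W: "vec.subspace W" "vec.dim W = 2" "l = {p \<in> CP2. p \<subseteq> W}"
    using assms by (auto simp: CP2_lines_def)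
  obtain f where "f \<noteq> 0" "W = {v. ev f v = 0}" using plane_form W(1,2) by blast
  with W(3) that show thesis by blast
qed

lemma CP2_vector:
  assumes "p \<in> CP2" obtains v where "v \<noteq> 0" "p = vec.span {v}"
proof -
  have p: "vec.subspace p" "vec.dim p = 1" using assms by (auto simp: CP2_def)
  obtain B where B: "vec.independent B" "vec.span B = p" "card B = 1"
    using vec.basis_subspace_exists[OF p(1)] p(2) by metis
  then obtain v where "B = {v}" by (meson card_1_singletonE)
  with B that show thesis by auto
qed

lemma span_in_CP2: assumes "v \<noteq> 0" shows "vec.span {v} \<in> CP2"
proof -
  have "vec.independent {v}" using assms by simp
  then show ?thesis by (simp add: CP2_def vec.dim_eq_card_independent)
qed

lemma ev_zero_on_span: "(\<forall>u\<in>vec.span {v}. ev f u = 0) \<longleftrightarrow> ev f v = 0"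
  by (auto simp: vec.span_singleton intro: vec.span_base)

definition form_of :: "proj_point set \<Rightarrow> complex ^ 3" where
  "form_of l = (SOME f. f \<noteq> 0 \<and> l = {p \<in> CP2. \<forall>v\<in>p. ev f v = 0})"

definition vec_of :: "proj_point \<Rightarrow> complex ^ 3" where
  "vec_of p = (SOME v. v \<noteq> 0 \<and> p = vec.span {v})"

lemma form_of:
  assumes "l \<in> CP2_lines"
  shows "form_of l \<noteq> 0" "l = {p \<in> CP2. \<forall>v\<in>p. ev (form_of l) v = 0}"
proof -
  have "\<exists>f. f \<noteq> 0 \<and> l = {p \<in> CP2. \<forall>v\<in>p. ev f v = 0}" by (rule CP2_line_form[OF assms]) blast
  from someI_ex[OF this]
  show "form_of l \<noteq> 0" "l = {p \<in> CP2. \<forall>v\<in>p. ev (form_of l) v = 0}"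
    unfolding form_of_def by blast+
qed

lemma vec_of:
  assumes "p \<in> CP2" shows "vec_of p \<noteq> 0" "p = vec.span {vec_of p}"
proof -
  have "\<exists>v. v \<noteq> 0 \<and> p = vec.span {v}" using CP2_vector[OF assms] by metis
  from someI_ex[OF this] show "vec_of p \<noteq> 0" "p = vec.span {vec_of p}"
    unfolding vec_of_def by blast+
qed

lemma span_in_line_iff:
  assumes "l \<in> CP2_lines" "v \<noteq> 0"
  shows "vec.span {v} \<in> l \<longleftrightarrow> ev (form_of l) v = 0"
proof -
  have "vec.span {v} \<in> l \<longleftrightarrow> (\<forall>u\<in>vec.span {v}. ev (form_of l) u = 0)"
    using form_of(2)[OF assms(1)] span_in_CP2[OF assms(2)] by blast
  then show ?thesis by (simp only: ev_zero_on_span)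
qed

lemma in_line_iff:
  assumes "l \<in> CP2_lines" "p \<in> CP2"
  shows "p \<in> l \<longleftrightarrow> ev (form_of l) (vec_of p) = 0"
  using span_in_line_iff[OF assms(1), of "vec_of p"] vec_of[OF assms(2)] by simp

lemma form_of_not_parallel:
  assumes "l \<in> CP2_lines" "m \<in> CP2_lines" "l \<noteq> m" shows "form_of l \<noteq> c *s form_of m"
proof
  assume *: "form_of l = c *s form_of m"
  with form_of(1)[OF assms(1)] have "c \<noteq> 0" by auto
  with * have "ev (form_of l) v = 0 \<longleftrightarrow> ev (form_of m) v = 0" for v by simp
  then have "l = m" by (subst form_of(2)[OF assms(1)], subst form_of(2)[OF assms(2)]) simp
  with assms(3) show False ..
qed

section \<open>Four lines attached to a quadrangle\<close>

text \<open>
  Up to scaling, \<open>l, l', m, m'\<close> are the sides of a parallelogram, the first diagonal has the form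
  \<open>n = l + m = l' + m'\<close>, and the second one then has the form \<open>l - m' = l' - m\<close>. The forms \<open>uA\<close>, \<open>uB\<close>, \<open>uC\<close>, \<open>uD\<close>
  are those of the lines which at the four vertices have the cross ratio \<open>\<kappa>\<close> with respect to
  the two sides and the diagonal; the signs are chosen to make their sum vanish. The vertex of \<open>uB\<close> is
  the one that lies on \<open>l\<close> together with the vertex of \<open>uA\<close>. The last part
  is where \<open>2 \<noteq> 0\<close> matters; it follows from \<open>uA + uD = l + l'\<close> and \<open>uA + uC = (1 - \<kappa>) (l - l')\<close>.
\<close>

lemma quadrangle_algebra:
  fixes l l' m m' :: "complex ^ 3"
  assumes indep: "\<forall>a b c. a *s l + b *s l' + c *s m = 0 \<longrightarrow> a = 0 \<and> b = 0 \<and> c = 0"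
    and n: "l + m = l' + m'" and \<kappa>: "\<kappa> \<noteq> 0" "\<kappa> \<noteq> 1"
  defines "uA \<equiv> l + \<kappa> *s m" and "uB \<equiv> \<kappa> *s m' - l"
    and "uC \<equiv> - l' - \<kappa> *s m'" and "uD \<equiv> l' - \<kappa> *s m"
  shows "uA + uB + uC + uD = 0"
    and "a *s uA + b *s uB + c *s uC + d *s uD = 0 \<Longrightarrow> b = a \<and> c = a \<and> d = a"
    and "l = (1/2) *s (uA + uD) + (1 / (2 * (1 - \<kappa>))) *s (uA + uC)"
proof -
  have m': "m' = l + m - l'" using n by (simp add: eq_diff_eq add.commute)
  show "uA + uB + uC + uD = 0"
    unfolding uA_def uB_def uC_def uD_def m' by (simp add: vec_eq_iff algebra_simps)
  show "b = a \<and> c = a \<and> d = a" if "a *s uA + b *s uB + c *s uC + d *s uD = 0"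
  proof -
    have "(a + b * (\<kappa> - 1) - c * \<kappa>) *s l + (d - b * \<kappa> + c * (\<kappa> - 1)) *s l'
        + (\<kappa> * (a + b - c - d)) *s m = a *s uA + b *s uB + c *s uC + d *s uD"
      unfolding uA_def uB_def uC_def uD_def m' by (simp add: vec_eq_iff algebra_simps)
    from indep[rule_format, OF trans[OF this that]] \<kappa>(1)
    have e: "a + b * (\<kappa> - 1) - c * \<kappa> = 0" "d - b * \<kappa> + c * (\<kappa> - 1) = 0" "a + b - c - d = 0"
      by auto
    then have "2 * (b - c) * (\<kappa> - 1) = 0" by algebra
    with \<kappa>(2) have "b = c" by simp
    with e show ?thesis by (auto simp: algebra_simps)
  qed
  have AC: "uA + uC = (1 - \<kappa>) *s (l - l')" and AD: "uA + uD = l + l'"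
    unfolding uA_def uC_def uD_def m' by (simp_all add: vec_eq_iff algebra_simps)
  have "(1 / (2 * (1 - \<kappa>))) * (1 - \<kappa>) = 1/2" using \<kappa>(2) by simp
  then have "(1 / (2 * (1 - \<kappa>))) *s (uA + uC) = (1/2) *s (l - l')"
    unfolding AC vec.scale_scale by (rule arg_cong)
  then show "l = (1/2) *s (uA + uD) + (1 / (2 * (1 - \<kappa>))) *s (uA + uC)"
    unfolding AD by (simp add: vec_eq_iff field_simps)
qed

section \<open>Nets and their cross ratio\<close>

locale net =
  fixes k :: nat and A :: "nat \<Rightarrow> proj_point set set" and X :: "proj_point set"
  assumes net: "is_net k A X"
begin

definition line :: "nat \<Rightarrow> proj_point \<Rightarrow> proj_point set" where
  "line i p = (THE l. l \<in> A i \<and> p \<in> l)"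

abbreviation form :: "nat \<Rightarrow> proj_point \<Rightarrow> complex ^ 3" where
  "form i p \<equiv> form_of (line i p)"

definition pts :: "nat \<Rightarrow> proj_point set \<Rightarrow> proj_point set" where
  "pts i l = {q \<in> X. line i q = l}"

lemma finite_class: "i \<in> {1..k} \<Longrightarrow> finite (A i)"
  and finite_X: "finite X"
  and line_CP2: "i \<in> {1..k} \<Longrightarrow> l \<in> A i \<Longrightarrow> l \<in> CP2_lines"
  and point_CP2: "p \<in> X \<Longrightarrow> p \<in> CP2"
  using net by (auto simp only: is_net_def)

lemma disjoint: "i \<in> {1..k} \<Longrightarrow> j \<in> {1..k} \<Longrightarrow> i \<noteq> j \<Longrightarrow> A i \<inter> A j = {}"
  using net unfolding is_net_def by (elim conjE) simp

lemma meet: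
  assumes "i \<in> {1..k}" "j \<in> {1..k}" "i \<noteq> j" "l \<in> A i" "m \<in> A j"
  shows "\<exists>p\<in>X. l \<inter> m = {p}"
  using net assms unfolding is_net_def by (elim conjE) simp

lemma unique_line: "i \<in> {1..k} \<Longrightarrow> p \<in> X \<Longrightarrow> \<exists>!l. l \<in> A i \<and> p \<in> l"
  using net unfolding is_net_def by (elim conjE) simp

lemma line_in: "i \<in> {1..k} \<Longrightarrow> p \<in> X \<Longrightarrow> line i p \<in> A i"
  and on_line: "i \<in> {1..k} \<Longrightarrow> p \<in> X \<Longrightarrow> p \<in> line i p"
  unfolding line_def using theI'[OF unique_line] by blast+

lemma line_eq: "i \<in> {1..k} \<Longrightarrow> p \<in> X \<Longrightarrow> l \<in> A i \<Longrightarrow> p \<in> l \<Longrightarrow> line i p = l"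
  using unique_line line_in on_line by blast

lemma ex_point:
  assumes "i \<in> {1..k}" "j \<in> {1..k}" "i \<noteq> j" "l \<in> A i" "m \<in> A j"
  obtains p where "p \<in> X" "line i p = l" "line j p = m"
  using meet[OF assms] line_eq assms by (metis Int_iff singletonI)

lemma point_eqI:
  assumes "i \<in> {1..k}" "j \<in> {1..k}" "i \<noteq> j" "p \<in> X" "q \<in> X" "line i p = line i q" "line j p = line j q"
  shows "p = q"
  using meet[OF assms(1-3), of "line i p" "line j p"] line_in on_line assms by (metis IntI singletonD)

lemma bij_points_on_line:
  assumes "i \<in> {1..k}" "j \<in> {1..k}" "i \<noteq> j" "l \<in> A i"
  shows "bij_betw (line j) (pts i l) (A j)"
proof (rule bij_betw_imageI)
  show "inj_on (line j) (pts i l)"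
    by (rule inj_onI) (use point_eqI[OF assms(1-3)] in \<open>auto simp: pts_def\<close>)
  show "line j ` pts i l = A j"
  proof (rule equalityI; rule subsetI)
    show "m \<in> A j" if "m \<in> line j ` pts i l" for m
      using that line_in[OF assms(2)] by (auto simp: pts_def)
    show "m \<in> line j ` pts i l" if m: "m \<in> A j" for m
    proof -
      obtain q where "q \<in> X" "line i q = l" "line j q = m" by (rule ex_point[OF assms m])
      then show ?thesis by (auto simp: pts_def)
    qed
  qed
qed

lemma form_nonzero: "i \<in> {1..k} \<Longrightarrow> l \<in> A i \<Longrightarrow> form_of l \<noteq> 0"
  using form_of(1) line_CP2 by blast

lemma forms_not_parallel:
  assumes "i \<in> {1..k}" "j \<in> {1..k}" "i \<noteq> j" "l \<in> A i" "m \<in> A j"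
  shows "form_of l \<noteq> c *s form_of m"
proof (rule form_of_not_parallel)
  show "l \<noteq> m" using disjoint[OF assms(1-3)] assms(4,5) by auto
qed (use line_CP2 assms in auto)

lemma vec_nonzero: "p \<in> X \<Longrightarrow> vec_of p \<noteq> 0"
  using vec_of(1) point_CP2 by blast

lemma ev_zero_iff:
  assumes "i \<in> {1..k}" "p \<in> X" "l \<in> A i"
  shows "ev (form_of l) (vec_of p) = 0 \<longleftrightarrow> line i p = l"
  using in_line_iff[of l p] line_CP2 point_CP2 line_eq on_line assms by metis

text \<open>
  If \<open>m\<close> passed through \<open>l \<inter> l'\<close>, that point would belong to \<open>X\<close> and lie on two lines of class \<open>i\<close>.
\<close>

lemma same_class_zero:
  assumes "i \<in> {1..k}" "j \<in> {1..k}" "i \<noteq> j" "l \<in> A i" "l' \<in> A i" "l \<noteq> l'" "m \<in> A j"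
    and "v \<noteq> 0" "ev (form_of l) v = 0" "ev (form_of l') v = 0"
  shows "ev (form_of m) v \<noteq> 0"
proof
  assume m: "ev (form_of m) v = 0"
  let ?p = "vec.span {v}"
  have on: "?p \<in> l" "?p \<in> l'" "?p \<in> m"
    using m assms line_CP2 by (simp_all add: span_in_line_iff)
  then have "?p \<in> X" using meet[OF assms(1-4,7)] by (metis IntI singletonD)
  then show False using on line_eq assms by metis
qed

text \<open>
  On a line of class \<open>i\<close> the product of class \<open>r\<close> is a multiple of the product of class \<open>j\<close>. Since the second
  product is nonzero at the intersection of two lines of class \<open>i\<close>, the two factors agree.
\<close>

lemma restriction_product_const:
  assumes ijr: "i \<in> {1..k}" "j \<in> {1..k}" "r \<in> {1..k}" "i \<noteq> j" "i \<noteq> r"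
    and nu: "\<And>p v. p \<in> X \<Longrightarrow> ev (form i p) v = 0 \<Longrightarrow> ev (form r p) v = nu p * ev (form j p) v"
    and l: "l \<in> A i" "l' \<in> A i"
  shows "prod nu (pts i l) = prod nu (pts i l')"
proof (cases "l = l'")
  case False
  obtain v where v: "v \<noteq> 0" "ev (form_of l) v = 0" "ev (form_of l') v = 0"
    using ex_common_zero by blast
  have split: "(\<Prod>c\<in>A r. ev (form_of c) v) = prod nu (pts i m) * (\<Prod>c\<in>A j. ev (form_of c) v)"
    if m: "m \<in> A i" "ev (form_of m) v = 0" for m
  proof -
    have "(\<Prod>c\<in>A r. ev (form_of c) v) = (\<Prod>q\<in>pts i m. ev (form r q) v)"
      by (rule prod.reindex_bij_betw[OF bij_points_on_line, symmetric]) (use ijr m in auto)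
    also have "\<dots> = (\<Prod>q\<in>pts i m. nu q * ev (form j q) v)"
      by (rule prod.cong) (use nu m in \<open>auto simp: pts_def\<close>)
    also have "\<dots> = prod nu (pts i m) * (\<Prod>q\<in>pts i m. ev (form j q) v)"
      by (rule prod.distrib)
    also have "(\<Prod>q\<in>pts i m. ev (form j q) v) = (\<Prod>c\<in>A j. ev (form_of c) v)"
      by (rule prod.reindex_bij_betw[OF bij_points_on_line]) (use ijr m in auto)
    finally show ?thesis .
  qed
  have "(\<Prod>c\<in>A j. ev (form_of c) v) \<noteq> 0"
    using same_class_zero[OF ijr(1,2,4) l False _ v] finite_class[OF ijr(2)] by simp
  with split[OF l(1) v(2)] split[OF l(2) v(3)] show ?thesis by simp
qed simp

text \<open>
  The derivative at \<open>p\<close> of the product of the forms of class \<open>j\<close> is this number times the form of \<open>line j p\<close>.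
\<close>

definition others :: "nat \<Rightarrow> proj_point \<Rightarrow> complex" where
  "others j p = (\<Prod>c\<in>A j - {line j p}. ev (form_of c) (vec_of p))"

lemma others_nonzero:
  assumes "j \<in> {1..k}" "p \<in> X" shows "others j p \<noteq> 0"
  using ev_zero_iff[OF assms] finite_class[OF assms(1)] by (auto simp: others_def)

lemma others_on_line:
  assumes "i \<in> {1..k}" "j \<in> {1..k}" "i \<noteq> j" "p \<in> X"
  shows "others j p = (\<Prod>q\<in>pts i (line i p) - {p}. ev (form j q) (vec_of p))"
  unfolding others_def
proof (rule prod.reindex_bij_betw[symmetric])
  have "p \<in> pts i (line i p)" using assms by (simp add: pts_def)
  moreover have "bij_betw (line j) (pts i (line i p)) (A j)"
    using bij_points_on_line assms line_in by blast
  ultimately show "bij_betw (line j) (pts i (line i p) - {p}) (A j - {line j p})"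
    by (intro bij_betw_DiffI) (auto simp: bij_betw_def)
qed

text \<open>
  In terms of the pencil: on a line of class \<open>i\<close> the product of class \<open>r\<close> is \<open>b\<close> times that of class \<open>j\<close>, and
  the equation compares the derivatives of both sides at \<open>p\<close>. It follows from
  \<open>restriction_product_const\<close> by separating the factor that belongs to \<open>p\<close>.
\<close>

lemma residue_const:
  assumes ijr: "i \<in> {1..k}" "j \<in> {1..k}" "r \<in> {1..k}" "i \<noteq> j" "i \<noteq> r"
    and nu: "\<And>p v. p \<in> X \<Longrightarrow> ev (form i p) v = 0 \<Longrightarrow> ev (form r p) v = nu p * ev (form j p) v"
    and nz: "\<And>p. p \<in> X \<Longrightarrow> nu p \<noteq> 0"
  obtains b where "b \<noteq> 0" "\<And>p. p \<in> X \<Longrightarrow> nu p * others r p = b * others j p"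
proof (cases "X = {}")
  case True
  then show ?thesis using that[of 1] by simp
next
  case False
  then obtain p0 where p0: "p0 \<in> X" by blast
  define b where "b = prod nu (pts i (line i p0))"
  have fin: "finite (pts i l)" for l using finite_X by (simp add: pts_def)
  show thesis
  proof
    show "b \<noteq> 0" unfolding b_def using nz fin by (auto simp: pts_def)
    fix p assume p: "p \<in> X"
    let ?Q = "pts i (line i p)"
    have "p \<in> ?Q" using p by (simp add: pts_def)
    have zero: "ev (form i q) (vec_of p) = 0" if "q \<in> ?Q" for q
      using that ev_zero_iff[OF ijr(1) p, of "line i p"] line_in[OF ijr(1) p] by (simp add: pts_def)
    have "nu p * others r p = nu p * (\<Prod>q\<in>?Q - {p}. nu q * ev (form j q) (vec_of p))"
      unfolding others_on_line[OF ijr(1,3,5) p]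
      using nu zero by (intro arg_cong[of _ _ "\<lambda>x. nu p * x"] prod.cong) (auto simp: pts_def)
    also have "\<dots> = (nu p * prod nu (?Q - {p})) * others j p"
      by (simp add: prod.distrib others_on_line[OF ijr(1,2,4) p])
    also have "nu p * prod nu (?Q - {p}) = prod nu ?Q"
      using \<open>p \<in> ?Q\<close> fin by (simp add: prod.remove)
    also have "\<dots> = b" unfolding b_def
      by (rule restriction_product_const[OF ijr nu]) (use line_in ijr p p0 in auto)
    finally show "nu p * others r p = b * others j p" .
  qed
qed

lemma pencil_at_point:
  assumes "i \<in> {1..k}" "j \<in> {1..k}" "r \<in> {1..k}" "i \<noteq> j" "i \<noteq> r" "j \<noteq> r" "p \<in> X"
  shows "\<exists>a b. a \<noteq> 0 \<and> b \<noteq> 0 \<and> form r p = a *s form i p + b *s form j p"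
proof -
  have line: "line i p \<in> A i" "line j p \<in> A j" "line r p \<in> A r" using line_in assms by auto
  have "ev (form i p) (vec_of p) = 0" "ev (form j p) (vec_of p) = 0" "ev (form r p) (vec_of p) = 0"
    using ev_zero_iff line assms by blast+
  then obtain a b where ab: "form r p = a *s form i p + b *s form j p"
    using in_pencil[OF vec_nonzero[OF assms(7)]] form_nonzero[OF assms(2) line(2)]
      forms_not_parallel[OF assms(1,2,4) line(1,2)] by metis
  have "a \<noteq> 0" using ab forms_not_parallel[of r j "line r p" "line j p" b] line assms by auto
  moreover have "b \<noteq> 0" using ab forms_not_parallel[of r i "line r p" "line i p" a] line assms by auto
  ultimately show ?thesis using ab by blast
qed

lemma pencil_residues:
  assumes ijr: "i \<in> {1..k}" "j \<in> {1..k}" "r \<in> {1..k}" "i \<noteq> j" "i \<noteq> r" "j \<noteq> r"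
  obtains mu nu a b where "a \<noteq> 0" "b \<noteq> 0"
    "\<And>p. p \<in> X \<Longrightarrow> mu p \<noteq> 0" "\<And>p. p \<in> X \<Longrightarrow> nu p \<noteq> 0"
    "\<And>p. p \<in> X \<Longrightarrow> form r p = mu p *s form i p + nu p *s form j p"
    "\<And>p. p \<in> X \<Longrightarrow> mu p * others r p = a * others i p"
    "\<And>p. p \<in> X \<Longrightarrow> nu p * others r p = b * others j p"
proof -
  have "\<forall>p\<in>X. \<exists>a b. a \<noteq> 0 \<and> b \<noteq> 0 \<and> form r p = a *s form i p + b *s form j p"
    using pencil_at_point[OF assms] by blast
  then obtain mu nu where mn: "\<And>p. p \<in> X \<Longrightarrow> mu p \<noteq> 0" "\<And>p. p \<in> X \<Longrightarrow> nu p \<noteq> 0"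
    "\<And>p. p \<in> X \<Longrightarrow> form r p = mu p *s form i p + nu p *s form j p" by metis
  obtain a where a: "a \<noteq> 0" "\<And>p. p \<in> X \<Longrightarrow> mu p * others r p = a * others i p"
    by (rule residue_const[of j i r mu]) (use ijr mn in auto)
  obtain b where b: "b \<noteq> 0" "\<And>p. p \<in> X \<Longrightarrow> nu p * others r p = b * others j p"
    by (rule residue_const[of i j r nu]) (use ijr mn in auto)
  show thesis using that a b mn by blast
qed

text \<open>
  The coefficients of the forms of classes \<open>r\<close> and \<open>s\<close> are quotients of values of \<open>others\<close> times
  constants. In the cross ratio these values cancel, and
  \<open>\<kappa>\<close> is a quotient of the constants.
\<close>

lemma cross_ratio_const:
  assumes cl: "i \<in> {1..k}" "j \<in> {1..k}" "r \<in> {1..k}" "s \<in> {1..k}" "distinct [i, j, r, s]"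
    and "X \<noteq> {}"
  obtains mu nu \<kappa> where "\<kappa> \<noteq> 0" "\<kappa> \<noteq> 1"
    "\<And>p. p \<in> X \<Longrightarrow> mu p \<noteq> 0" "\<And>p. p \<in> X \<Longrightarrow> nu p \<noteq> 0"
    "\<And>p. p \<in> X \<Longrightarrow> form r p = mu p *s form i p + nu p *s form j p"
    "\<And>p. p \<in> X \<Longrightarrow> \<exists>c. c \<noteq> 0 \<and> form s p = c *s (mu p *s form i p + (\<kappa> * nu p) *s form j p)"
proof -
  obtain mu nu a b where r: "a \<noteq> 0" "b \<noteq> 0"
    "\<And>p. p \<in> X \<Longrightarrow> mu p \<noteq> 0" "\<And>p. p \<in> X \<Longrightarrow> nu p \<noteq> 0"
    "\<And>p. p \<in> X \<Longrightarrow> form r p = mu p *s form i p + nu p *s form j p"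
    "\<And>p. p \<in> X \<Longrightarrow> mu p * others r p = a * others i p"
    "\<And>p. p \<in> X \<Longrightarrow> nu p * others r p = b * others j p"
    by (rule pencil_residues[of i j r]) (use cl in auto)
  obtain mu' nu' a' b' where s: "a' \<noteq> 0" "b' \<noteq> 0"
    "\<And>p. p \<in> X \<Longrightarrow> mu' p \<noteq> 0" "\<And>p. p \<in> X \<Longrightarrow> nu' p \<noteq> 0"
    "\<And>p. p \<in> X \<Longrightarrow> form s p = mu' p *s form i p + nu' p *s form j p"
    "\<And>p. p \<in> X \<Longrightarrow> mu' p * others s p = a' * others i p"
    "\<And>p. p \<in> X \<Longrightarrow> nu' p * others s p = b' * others j p"
    by (rule pencil_residues[of i j s]) (use cl in auto)
  define \<kappa> where "\<kappa> = a * b' / (b * a')"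
  have ratio: "nu' p = (mu' p / mu p) * (\<kappa> * nu p)" if p: "p \<in> X" for p
  proof -
    let ?P = "others r p * others s p * others i p * others j p"
    have "?P \<noteq> 0" using p others_nonzero cl by auto
    moreover have "(nu' p * mu p * b * a') * ?P = (mu' p * nu p * a * b') * ?P"
    proof -
      have "(nu' p * mu p * b * a') * ?P
          = (nu' p * others s p) * (mu p * others r p) * (b * others j p) * (a' * others i p)"
        by (simp add: algebra_simps)
      also have "\<dots> = (b' * others j p) * (a * others i p) * (nu p * others r p) * (mu' p * others s p)"
        by (simp only: r(6,7)[OF p] s(6,7)[OF p])
      finally show ?thesis by (simp add: algebra_simps)
    qed
    ultimately have "nu' p * mu p * b * a' = mu' p * nu p * a * b'" by simp
    then show ?thesis using r(1-3) s(1) p by (simp add: \<kappa>_def field_simps)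
  qed
  have fs: "form s p = (mu' p / mu p) *s (mu p *s form i p + (\<kappa> * nu p) *s form j p)"
    if p: "p \<in> X" for p
    using ratio[OF p] s(5)[OF p] r(3)[OF p] by (simp add: vec.scale_right_distrib)
  have "\<kappa> \<noteq> 1"
  proof
    assume "\<kappa> = 1"
    obtain p where p: "p \<in> X" using \<open>X \<noteq> {}\<close> by blast
    have "form s p = (mu' p / mu p) *s form r p" using fs[OF p] r(5)[OF p] \<open>\<kappa> = 1\<close> by simp
    then show False
      using forms_not_parallel[of s r "line s p" "line r p"] line_in[OF _ p] cl by auto
  qed
  moreover have "\<kappa> \<noteq> 0" using r s by (simp add: \<kappa>_def)
  moreover have "\<exists>c. c \<noteq> 0 \<and> form s p = c *s (mu p *s form i p + (\<kappa> * nu p) *s form j p)"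
    if "p \<in> X" for p using fs r(3) s(3) that by (intro exI[of _ "mu' p / mu p"]) auto
  ultimately show thesis using that r(3-5) by blast
qed

section \<open>Incidences in a net with four classes of four lines\<close>

text \<open>
  The lines through \<open>p\<close> of the \<open>k - 1\<close> classes other than \<open>i\<close> meet \<open>line i q\<close> in different
  points, all of them distinct from \<open>q\<close>. Since the line carries only \<open>k\<close> points, these are all points but \<open>q\<close>. Hence
  at most one point of a line that avoids \<open>p\<close> is not joined with \<open>p\<close>. So being equal or not joined
  is an equivalence relation; its classes are the lines of the missing parallel class of an affine plane.
\<close>

lemma collinear_if_noncollinear:
  assumes card: "\<And>j. j \<in> {1..k} \<Longrightarrow> card (A j) = k"
    and X: "p \<in> X" "q \<in> X" "q' \<in> X" and i: "i \<in> {1..k}"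
    and q: "q \<noteq> q'" "line i q = line i q'" and non: "\<And>j. j \<in> {1..k} \<Longrightarrow> line j p \<noteq> line j q"
  obtains j where "j \<in> {1..k}" "j \<noteq> i" "line j p = line j q'"
proof -
  let ?J = "{1..k} - {i}" and ?S = "pts i (line i q)"
  have "\<exists>x\<in>X. line i x = line i q \<and> line j x = line j p" if j: "j \<in> ?J" for j
  proof -
    obtain x where "x \<in> X" "line i x = line i q" "line j x = line j p"
      by (rule ex_point[of i j "line i q" "line j p"]) (use line_in i X j in auto)
    then show ?thesis by blast
  qed
  then obtain f where f: "\<And>j. j \<in> ?J \<Longrightarrow> f j \<in> X"
    "\<And>j. j \<in> ?J \<Longrightarrow> line i (f j) = line i q" "\<And>j. j \<in> ?J \<Longrightarrow> line j (f j) = line j p"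
    by metis
  have "inj_on f ?J"
  proof (rule inj_onI, rule ccontr)
    fix j j' assume j: "j \<in> ?J" "j' \<in> ?J" "f j = f j'" "j \<noteq> j'"
    have "line j (f j) = line j p" "line j' (f j) = line j' p" using f(3) j by metis+
    then have "f j = p" by (intro point_eqI[of j j']) (use f(1) j X in auto)
    then have "line i p = line i q" using f(2) j(1) by metis
    with non i show False by blast
  qed
  then have cf: "card (f ` ?J) = k - 1" using i by (simp add: card_image)
  have "k > 1" using net by (simp add: is_net_def)
  define j0 :: nat where "j0 = (if i = 1 then 2 else 1)"
  have j0: "j0 \<in> {1..k}" "j0 \<noteq> i" using \<open>k > 1\<close> by (simp_all add: j0_def)
  have "card ?S = k"
    using bij_betw_same_card[OF bij_points_on_line[OF i j0(1)]] j0 card line_in i X by auto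
  then have "card (?S - {q}) = k - 1" using X by (simp add: pts_def)
  moreover note cf
  moreover have "f ` ?J \<subseteq> ?S - {q}" using f non by (force simp: pts_def)
  moreover have "finite (?S - {q})" using finite_X by (simp add: pts_def)
  ultimately have "f ` ?J = ?S - {q}" by (intro card_subset_eq) auto
  moreover have "q' \<in> ?S - {q}" using X q by (auto simp: pts_def)
  ultimately obtain j where "j \<in> ?J" "q' = f j" by blast
  with f(3) that show thesis by auto
qed

end

locale net_4_4 = net 4 A X for A X +
  assumes card_class: "\<And>i. i \<in> {1..4} \<Longrightarrow> card (A i) = 4" and X_nonempty: "X \<noteq> {}"
begin

lemma share_two:
  assumes "p \<in> X" "q \<in> X" "i \<in> {1,2,3,4}" "j \<in> {1,2,3,4}" "i \<noteq> j" "line i p = line i q" "line j p = line j q"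
  shows "p = q"
  by (rule point_eqI[of i j]) (use assms in auto)

lemma collinear4:
  assumes "p \<in> X" "q \<in> X" "q' \<in> X" "i \<in> {1,2,3,4}" "q \<noteq> q'" "line i q = line i q'"
    and "line 1 p \<noteq> line 1 q" "line 2 p \<noteq> line 2 q" "line 3 p \<noteq> line 3 q" "line 4 p \<noteq> line 4 q"
  shows "line 1 p = line 1 q' \<or> line 2 p = line 2 q' \<or> line 3 p = line 3 q' \<or> line 4 p = line 4 q'"
proof -
  have four: "j = 1 \<or> j = 2 \<or> j = 3 \<or> j = 4" if "j \<in> {1..4}" for j :: nat using that by auto
  have non: "line j p \<noteq> line j q" if "j \<in> {1..4}" for j using four[OF that] assms by auto
  obtain j where "j \<in> {1..4}" "line j p = line j q'"
    by (rule collinear_if_noncollinear[of p q q' i]) (use card_class assms non in auto)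
  then show ?thesis using four by metis
qed

lemma card_pts: assumes "i \<in> {1..4}" "l \<in> A i" shows "card (pts i l) = 4"
proof -
  define j :: nat where "j = (if i = 1 then 2 else 1)"
  have j: "j \<in> {1..4}" "i \<noteq> j" by (simp_all add: j_def)
  show ?thesis using bij_betw_same_card[OF bij_points_on_line[OF assms(1) j assms(2)]] card_class j by simp
qed

lemma ex_avoiding:
  assumes "i \<in> {1..4}" "p \<in> X" "card F \<le> 3" "finite F"
  obtains q where "q \<in> X" "line i q = line i p" "q \<notin> F"
proof -
  have "card (pts i (line i p)) = 4" using card_pts line_in assms by blast
  then have "\<not> pts i (line i p) \<subseteq> F" using card_mono[OF assms(4), of "pts i (line i p)"] assms(3) by auto
  then show thesis using that by (auto simp: pts_def)
qed

text \<open>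
  The Fano property of the affine plane of order four. Otherwise \<open>q\<close> and \<open>s\<close> are joined by a line of
  class 4 or not joined at all. The line of class 4 through \<open>q\<close> meets the diagonal through \<open>p\<close> and \<open>r\<close> in
  a point \<open>g\<close>. If \<open>q\<close> and \<open>s\<close> are not joined, then \<open>s\<close> must be
  joined with \<open>g\<close>, but every class of lines excludes this. If they are joined, the fourth point \<open>h\<close> of
  their line is joined neither with \<open>p\<close> nor with \<open>r\<close>, although \<open>p\<close> and \<open>r\<close> lie on a line.
\<close>

lemma parallelogram:
  assumes X: "p \<in> X" "q \<in> X" "r \<in> X" "s \<in> X" and "p \<noteq> r"
    and 1: "line 1 p = line 1 q" "line 1 r = line 1 s"
    and 2: "line 2 p = line 2 s" "line 2 q = line 2 r"
    and 3: "line 3 p = line 3 r"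
  shows "line 3 q = line 3 s"
proof (rule ccontr)
  assume ne: "line 3 q \<noteq> line 3 s"
  note eq = share_two
  have pq: "p \<noteq> q" using eq[of p r 2 3] X 2 3 \<open>p \<noteq> r\<close> by auto
  have qr: "q \<noteq> r" using eq[of p r 1 3] X 1 3 \<open>p \<noteq> r\<close> by auto
  have rs: "r \<noteq> s" using eq[of p r 2 3] X 2 3 \<open>p \<noteq> r\<close> by auto
  have ps: "p \<noteq> s" using eq[of p r 1 3] X 1 3 \<open>p \<noteq> r\<close> by auto
  have qs1: "line 1 q \<noteq> line 1 s" using eq[of p r 1 3] X 1 3 \<open>p \<noteq> r\<close> by auto
  have qs2: "line 2 q \<noteq> line 2 s" using eq[of p r 2 3] X 2 3 \<open>p \<noteq> r\<close> by auto
  obtain g where g: "g \<in> X" "line 3 g = line 3 p" "line 4 g = line 4 q"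
    by (rule ex_point[of 3 4 "line 3 p" "line 4 q"]) (use line_in[of 3 p] line_in[of 4 q] X in auto)
  have gp: "g \<noteq> p" using eq[of p q 1 4] X 1 g pq by auto
  have gr: "g \<noteq> r" using eq[of q r 2 4] X 2 g qr by auto
  have gq: "g \<noteq> q" using eq[of p q 1 3] X 1 g pq by auto
  show False
  proof (cases "line 4 q = line 4 s")
    case False
    have "line 1 s = line 1 g \<or> line 2 s = line 2 g \<or> line 3 s = line 3 g \<or> line 4 s = line 4 g"
      by (rule collinear4[of s q g 4]) (use X g gq qs1 qs2 ne False in auto)
    then show False
      using eq[of g r 1 3] eq[of g p 2 3] eq[of p s 2 3] False X g gp gr ps 1 2 3 by auto
  next
    case True
    obtain h where h: "h \<in> X" "line 4 h = line 4 q" "h \<notin> {q, s, g}"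
      by (rule ex_avoiding[of 4 q "{q, s, g}"]) (use X in \<open>auto simp: card_insert_if\<close>)
    have "line 1 h \<noteq> line 1 p" using eq[of h q 1 4] X h 1 by auto
    moreover have "line 2 h \<noteq> line 2 p" using eq[of h s 2 4] X h 2 True by auto
    moreover have "line 3 h \<noteq> line 3 p" using eq[of h g 3 4] X h g by auto
    moreover have "line 4 h \<noteq> line 4 p" using eq[of p q 1 4] X h 1 pq by auto
    ultimately have "line 1 h = line 1 r \<or> line 2 h = line 2 r \<or> line 3 h = line 3 r \<or> line 4 h = line 4 r"
      by (intro collinear4[of h p r 3]) (use X h 3 \<open>p \<noteq> r\<close> in auto)
    then show False
      using eq[of h s 1 4] eq[of h q 2 4] eq[of h g 3 4] eq[of q r 2 4] X h g 1 2 3 qr True by auto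
  qed
qed

section \<open>Two quadrangles with a common side\<close>

text \<open>
  The functions \<open>w\<close> and \<open>g\<close> are defined on the lines of class 4 rather than on the vertices so that two
  parallelograms can be compared. The weights \<open>w\<close> span the linear relations among the four forms, so the
  coefficients \<open>g\<close> are determined up to an additive constant once \<open>w\<close> is chosen. The last equation is
  invariant under adding constants to \<open>g\<close>; it says that the line through \<open>p\<close> and \<open>q\<close> passes through the diagonal
  point that belongs to the pair of lines of class 4 through \<open>p\<close> and \<open>q\<close>.
\<close>

lemma side_through_diagonal_point:
  assumes \<kappa>: "\<kappa> \<noteq> 0" "\<kappa> \<noteq> 1"
    and mn: "\<And>p. p \<in> X \<Longrightarrow> mu p \<noteq> 0" "\<And>p. p \<in> X \<Longrightarrow> nu p \<noteq> 0"
    and f3: "\<And>p. p \<in> X \<Longrightarrow> form 3 p = mu p *s form 1 p + nu p *s form 2 p"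
    and f4: "\<And>p. p \<in> X \<Longrightarrow> \<exists>c. c \<noteq> 0 \<and> form 4 p = c *s (mu p *s form 1 p + (\<kappa> * nu p) *s form 2 p)"
    and X: "p \<in> X" "q \<in> X" "r \<in> X" and "p \<noteq> r"
    and 1: "line 1 p = line 1 q" and 2: "line 2 q = line 2 r" and 3: "line 3 p = line 3 r"
  obtains w g where "\<And>c. c \<in> A 4 \<Longrightarrow> w c \<noteq> 0" "(\<Sum>c\<in>A 4. w c *s form_of c) = 0"
    "\<And>z. (\<Sum>c\<in>A 4. z c *s form_of c) = 0 \<Longrightarrow> \<exists>t. \<forall>c\<in>A 4. z c = t * w c"
    "form 1 p = (\<Sum>c\<in>A 4. (g c * w c) *s form_of c)"
    "2 * (g (line 4 p) + g (line 4 q)) = (\<Sum>c\<in>A 4. g c)"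
proof -
  note eq = share_two
  obtain s where s: "s \<in> X" "line 1 s = line 1 r" "line 2 s = line 2 p"
    by (rule ex_point[of 1 2 "line 1 r" "line 2 p"]) (use line_in[of 1 r] line_in[of 2 p] X in auto)
  have s3: "line 3 q = line 3 s" by (rule parallelogram[of p q r s]) (use X s 1 2 3 \<open>p \<noteq> r\<close> in auto)
  have pq: "p \<noteq> q" using eq[of p r 2 3] X 2 3 \<open>p \<noteq> r\<close> by auto
  have qr: "q \<noteq> r" using eq[of p r 1 3] X 1 3 \<open>p \<noteq> r\<close> by auto
  have rs: "r \<noteq> s" using eq[of p r 2 3] X s 3 \<open>p \<noteq> r\<close> by auto
  have ps: "p \<noteq> s" using eq[of p r 1 3] X s 3 \<open>p \<noteq> r\<close> by auto
  have l12: "line 1 p \<noteq> line 1 r" "line 2 p \<noteq> line 2 r" using eq[of p r 1 3] eq[of p r 2 3] X 3 \<open>p \<noteq> r\<close> by auto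
  have qs: "q \<noteq> s" using l12 1 s by auto
  have K: "distinct [line 4 p, line 4 q, line 4 r, line 4 s]"
    using eq[of p q 1 4] eq[of q r 2 4] eq[of r s 1 4] eq[of p s 2 4] eq[of p r 3 4] eq[of q s 3 4]
      X s 1 2 3 s3 pq qr rs ps qs \<open>p \<noteq> r\<close> by auto
  have "{line 4 p, line 4 q, line 4 r, line 4 s} = A 4"
    by (rule card_subset_eq) (use K card_class[of 4] finite_class[of 4] line_in X s in auto)
  note A4 = this[symmetric]
  have sum4: "(\<Sum>c\<in>A 4. h c) = h (line 4 p) + h (line 4 q) + h (line 4 r) + h (line 4 s)"
    for h :: "proj_point set \<Rightarrow> 'b::comm_monoid_add"
    unfolding A4 using K by (simp add: add.assoc)
  define l where "l = mu p *s form 1 p"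
  define m where "m = nu p *s form 2 p"
  define l' where "l' = mu r *s form 1 r"
  define m' where "m' = nu r *s form 2 r"
  have n: "l + m = l' + m'" using f3[OF X(1)] f3[OF X(3)] 3 by (simp add: l_def m_def l'_def m'_def)
  have indep: "a = 0 \<and> b = 0 \<and> c = 0" if rel: "a *s l + b *s l' + c *s m = 0" for a b c
  proof -
    have at: "a * ev l v + b * ev l' v + c * ev m v = 0" for v
      using arg_cong[OF rel, of "\<lambda>f. ev f v"] by simp
    \<comment> \<open>The coefficients vanish by evaluation at the intersection of the two lines of class 1, at \<open>p\<close>
      and at \<open>r\<close>.\<close>
    obtain v where v: "v \<noteq> 0" "ev (form 1 p) v = 0" "ev (form 1 r) v = 0" using ex_common_zero by blast
    have "ev (form 2 p) v \<noteq> 0"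
      by (rule same_class_zero[of 1 2 "line 1 p" "line 1 r"]) (use v l12 line_in X in auto)
    then have "c = 0" using at[of v] v mn(2)[OF X(1)] by (simp add: l_def l'_def m_def)
    have "ev (form 1 p) (vec_of p) = 0" "ev (form 1 r) (vec_of p) \<noteq> 0"
      using ev_zero_iff[of 1 p] l12 line_in X by auto
    then have "b = 0" using at[of "vec_of p"] \<open>c = 0\<close> mn(1)[OF X(3)] by (simp add: l_def l'_def)
    have "ev (form 1 p) (vec_of r) \<noteq> 0"
      using ev_zero_iff[of 1 r] l12 line_in X by auto
    then have "a = 0" using at[of "vec_of r"] \<open>c = 0\<close> \<open>b = 0\<close> mn(1)[OF X(1)] by (simp add: l_def)
    with \<open>b = 0\<close> \<open>c = 0\<close> show ?thesis by simp
  qed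
  then have indep': "\<forall>a b c. a *s l + b *s l' + c *s m = 0 \<longrightarrow> a = 0 \<and> b = 0 \<and> c = 0" by blast
  \<comment> \<open>The form of the second diagonal is expanded at \<open>q\<close> and at \<open>s\<close>; as \<open>l, l', m\<close> are independent, it
    must be \<open>x (l - m') = x (l' - m)\<close>.\<close>
  define x where "x = mu q / mu p"
  define y where "y = nu q / nu r"
  have x: "x \<noteq> 0" using mn X by (simp add: x_def)
  have q: "mu q *s form 1 q = x *s l" "nu q *s form 2 q = y *s m'"
    using mn X 1 2 by (simp_all add: x_def y_def l_def m'_def)
  have sx: "mu s *s form 1 s = (mu s / mu r) *s l'" "nu s *s form 2 s = (nu s / nu p) *s m"
    using mn X s by (simp_all add: l'_def m_def)
  have "x *s l + y *s m' = (mu s / mu r) *s l' + (nu s / nu p) *s m"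
    using f3[OF X(2)] f3[OF s(1)] s3 q sx by simp
  moreover have "m' = l + m - l'" using n by (simp add: eq_diff_eq add.commute)
  ultimately have "(x + y) *s l + (- y - mu s / mu r) *s l' + (y - nu s / nu p) *s m = 0"
    by (simp add: vec_eq_iff algebra_simps)
  from indep[OF this] have "x + y = 0" "- y - mu s / mu r = 0" "y - nu s / nu p = 0" by blast+
  then have t: "mu s / mu r = - y" "nu s / nu p = y" and "y = - x"
    by (simp_all only: eq_iff_diff_eq_0[symmetric] eq_neg_iff_add_eq_0 add.commute)
  then have xy: "y = - x" "mu s / mu r = x" "nu s / nu p = - x" by simp_all
  define uA where "uA = l + \<kappa> *s m"
  define uB where "uB = \<kappa> *s m' - l"
  define uC where "uC = - l' - \<kappa> *s m'"
  define uD where "uD = l' - \<kappa> *s m"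
  note alg = quadrangle_algebra[OF indep' n \<kappa>, folded uA_def uB_def uC_def uD_def]
  have scale: "\<exists>c. c \<noteq> 0 \<and> c *s form 4 t = u"
    if t: "t \<in> X" "mu t *s form 1 t + (\<kappa> * nu t) *s form 2 t = a *s u" and "a \<noteq> 0" for t a u
  proof -
    obtain c where "c \<noteq> 0" "form 4 t = c *s (a *s u)" using f4[OF t(1)] unfolding t(2) by blast
    then show ?thesis using \<open>a \<noteq> 0\<close> by (intro exI[of _ "1 / (c * a)"]) simp
  qed
  have "mu p *s form 1 p + (\<kappa> * nu p) *s form 2 p = 1 *s uA"
    by (simp add: uA_def l_def m_def)
  from scale[OF X(1) this one_neq_zero]
  obtain a where a: "a \<noteq> 0" "a *s form 4 p = uA" by blast
  have "mu q *s form 1 q + (\<kappa> * nu q) *s form 2 q = mu q *s form 1 q + \<kappa> *s (nu q *s form 2 q)"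
    by simp
  also have "\<dots> = (- x) *s uB" unfolding q uB_def xy(1) by (simp add: vec_eq_iff algebra_simps)
  finally have "mu q *s form 1 q + (\<kappa> * nu q) *s form 2 q = (- x) *s uB" .
  from scale[OF X(2) this] x obtain b where b: "b \<noteq> 0" "b *s form 4 q = uB"
    unfolding neg_equal_0_iff_equal by blast
  have "mu r *s form 1 r + (\<kappa> * nu r) *s form 2 r = (- 1) *s uC"
    by (simp add: uC_def l'_def m'_def vec_eq_iff)
  from scale[OF X(3) this] obtain c where c: "c \<noteq> 0" "c *s form 4 r = uC"
    using one_neq_neg_one neg_equal_0_iff_equal one_neq_zero by blast
  have "mu s *s form 1 s + (\<kappa> * nu s) *s form 2 s = mu s *s form 1 s + \<kappa> *s (nu s *s form 2 s)"
    by simp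
  also have "\<dots> = x *s uD" unfolding sx uD_def xy(2,3) by (simp add: vec_eq_iff algebra_simps)
  finally have "mu s *s form 1 s + (\<kappa> * nu s) *s form 2 s = x *s uD" .
  from scale[OF s(1) this x] obtain d where d: "d \<noteq> 0" "d *s form 4 s = uD" by blast
  have K': "line 4 q \<noteq> line 4 p" "line 4 r \<noteq> line 4 p" "line 4 s \<noteq> line 4 p" "line 4 r \<noteq> line 4 q"
    "line 4 s \<noteq> line 4 q" "line 4 s \<noteq> line 4 r" using K by auto
  define on_K :: "complex \<Rightarrow> complex \<Rightarrow> complex \<Rightarrow> complex \<Rightarrow> proj_point set \<Rightarrow> complex" where
    "on_K = (\<lambda>e1 e2 e3 e4 h. if h = line 4 p then e1 else if h = line 4 q then e2 else if h = line 4 r then e3 else e4)"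
  have on_K: "on_K e1 e2 e3 e4 (line 4 p) = e1" "on_K e1 e2 e3 e4 (line 4 q) = e2"
    "on_K e1 e2 e3 e4 (line 4 r) = e3" "on_K e1 e2 e3 e4 (line 4 s) = e4" for e1 e2 e3 e4
    unfolding on_K_def by (simp_all only: K' if_True if_False refl simp_thms)
  define e where "e = 1 / (2 * (1 - \<kappa>))"
  define w where "w = on_K a b c d"
  \<comment> \<open>The coefficients of \<open>quadrangle_algebra\<close> for \<open>l = mu p *s form 1 p\<close>, with \<open>uB\<close> not occurring.\<close>
  define g where "g = on_K ((1/2 + e) / mu p) 0 (e / mu p) ((1/2) / mu p)"
  show thesis
  proof
    show "w h \<noteq> 0" if "h \<in> A 4" for h
      using that a b c d unfolding A4 by (auto simp: w_def on_K)
    show "(\<Sum>c\<in>A 4. w c *s form_of c) = 0"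
      unfolding sum4 w_def on_K a b c d by (rule alg(1))
    show "\<exists>t. \<forall>h\<in>A 4. z h = t * w h" if z: "(\<Sum>c\<in>A 4. z c *s form_of c) = 0" for z
    proof -
      have "(z (line 4 p) / a) *s uA + (z (line 4 q) / b) *s uB + (z (line 4 r) / c) *s uC + (z (line 4 s) / d) *s uD = 0"
        using z unfolding sum4 a(2)[symmetric] b(2)[symmetric] c(2)[symmetric] d(2)[symmetric]
        using a(1) b(1) c(1) d(1) by simp
      from alg(2)[OF this] have "z h = (z (line 4 p) / a) * w h" if "h \<in> A 4" for h
        using that a b c d unfolding A4 by (auto simp: w_def on_K field_simps)
      then show ?thesis by blast
    qed
    have "form 1 p = (1 / mu p) *s l" using mn(1)[OF X(1)] by (simp add: l_def)
    also have "l = (1/2) *s (uA + uD) + e *s (uA + uC)" using alg(3) by (simp add: e_def)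
    also have "(1 / mu p) *s \<dots> = ((1/2 + e) / mu p) *s uA + (e / mu p) *s uC + ((1/2) / mu p) *s uD"
      by (simp add: vec_eq_iff algebra_simps add_divide_distrib)
    finally show "form 1 p = (\<Sum>c\<in>A 4. (g c * w c) *s form_of c)"
      unfolding sum4 w_def g_def on_K a(2)[symmetric] c(2)[symmetric] d(2)[symmetric] by simp
    show "2 * (g (line 4 p) + g (line 4 q)) = (\<Sum>c\<in>A 4. g c)"
      unfolding sum4 g_def on_K by (simp add: add_divide_distrib)
  qed
qed


text \<open>
  Both parallelograms have their side of class 1 on the line of \<open>p\<close>. Both equations for
  \<open>g\<close> together mean that \<open>g\<close> takes one value at \<open>d\<close> and the line of class 4 through \<open>p\<close> and one at the two other
  lines; the second value can be shifted to zero by the relation \<open>w\<close>.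
\<close>

lemma no_net_4_4: False
proof -
  obtain p where p: "p \<in> X" using X_nonempty by blast
  obtain r where r: "r \<in> X" "line 3 r = line 3 p" "r \<noteq> p"
    by (rule ex_avoiding[of 3 p "{p}"]) (use p in auto)
  obtain r' where r': "r' \<in> X" "line 3 r' = line 3 p" "r' \<noteq> p" "r' \<noteq> r"
    by (rule ex_avoiding[of 3 p "{p, r}"]) (use p in \<open>auto simp: card_insert_if\<close>)
  obtain q where q: "q \<in> X" "line 1 q = line 1 p" "line 2 q = line 2 r"
    by (rule ex_point[of 1 2 "line 1 p" "line 2 r"]) (use line_in[of 1 p] line_in[of 2 r] p r in auto)
  obtain q' where q': "q' \<in> X" "line 1 q' = line 1 p" "line 2 q' = line 2 r'"
    by (rule ex_point[of 1 2 "line 1 p" "line 2 r'"]) (use line_in[of 1 p] line_in[of 2 r'] p r' in auto)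
  have "p \<noteq> q" using share_two[of p r 2 3] p q r by auto
  then have pq: "line 4 p \<noteq> line 4 q" using share_two[of p q 1 4] p q by auto
  have "p \<noteq> q'" using share_two[of p r' 2 3] p q' r' by auto
  then have pq': "line 4 p \<noteq> line 4 q'" using share_two[of p q' 1 4] p q' by auto
  have "q \<noteq> q'" using share_two[of r r' 2 3] q q' r r' by auto
  then have qq': "line 4 q \<noteq> line 4 q'" using share_two[of q q' 1 4] q q' by auto
  have sub: "{line 4 p, line 4 q, line 4 q'} \<subseteq> A 4" using line_in[of 4] p q q' by auto
  have "card (A 4 - {line 4 p, line 4 q, line 4 q'}) = 1"
    using pq pq' qq' card_class[of 4] sub by (subst card_Diff_subset) auto
  then obtain d where "A 4 - {line 4 p, line 4 q, line 4 q'} = {d}" by (rule card_1_singletonE)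
  then have A4: "A 4 = {line 4 p, line 4 q, line 4 q', d}" and d: "d \<noteq> line 4 p" "d \<noteq> line 4 q" "d \<noteq> line 4 q'"
    using sub by blast+
  have sum4: "(\<Sum>c\<in>A 4. h c) = h (line 4 p) + h (line 4 q) + h (line 4 q') + h d"
    for h :: "proj_point set \<Rightarrow> 'b::comm_monoid_add"
    unfolding A4 using pq pq' qq' d by (simp add: add.assoc)
  obtain \<kappa> mu nu where cr: "\<kappa> \<noteq> 0" "\<kappa> \<noteq> 1"
    "\<And>p. p \<in> X \<Longrightarrow> mu p \<noteq> 0" "\<And>p. p \<in> X \<Longrightarrow> nu p \<noteq> 0"
    "\<And>p. p \<in> X \<Longrightarrow> form 3 p = mu p *s form 1 p + nu p *s form 2 p"
    "\<And>p. p \<in> X \<Longrightarrow> \<exists>c. c \<noteq> 0 \<and> form 4 p = c *s (mu p *s form 1 p + (\<kappa> * nu p) *s form 2 p)"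
    by (rule cross_ratio_const[of 1 2 3 4]) (use X_nonempty in auto)
  obtain w g where w: "\<And>c. c \<in> A 4 \<Longrightarrow> w c \<noteq> 0" "(\<Sum>c\<in>A 4. w c *s form_of c) = 0"
    "\<And>z. (\<Sum>c\<in>A 4. z c *s form_of c) = 0 \<Longrightarrow> \<exists>t. \<forall>c\<in>A 4. z c = t * w c"
    and g: "form 1 p = (\<Sum>c\<in>A 4. (g c * w c) *s form_of c)"
    "2 * (g (line 4 p) + g (line 4 q)) = (\<Sum>c\<in>A 4. g c)"
    by (rule side_through_diagonal_point[OF cr, of p q r]) (use p q r in auto)
  obtain w' g' where w': "\<And>c. c \<in> A 4 \<Longrightarrow> w' c \<noteq> 0" "(\<Sum>c\<in>A 4. w' c *s form_of c) = 0"
    and g': "form 1 p = (\<Sum>c\<in>A 4. (g' c * w' c) *s form_of c)"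
    "2 * (g' (line 4 p) + g' (line 4 q')) = (\<Sum>c\<in>A 4. g' c)"
    by (rule side_through_diagonal_point[OF cr, of p q' r']) (use p q' r' in auto)
  obtain t where t: "\<And>c. c \<in> A 4 \<Longrightarrow> w' c = t * w c" using w(3)[OF w'(2)] by blast
  have "(\<Sum>c\<in>A 4. (g' c * w' c - g c * w c) *s form_of c) = 0"
    using g(1) g'(1) by (simp add: vec.scale_left_diff_distrib sum_subtractf)
  from w(3)[OF this] obtain u where u: "\<And>c. c \<in> A 4 \<Longrightarrow> g' c * w' c - g c * w c = u * w c" by blast
  have gg: "g c = t * g' c - u" if "c \<in> A 4" for c
  proof -
    have "w c * g c = w c * (t * g' c - u)" using u[OF that] t[OF that] by (simp add: algebra_simps)
    with w(1)[OF that] show ?thesis by (metis mult_left_cancel)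
  qed
  have "2 * (g (line 4 p) + g (line 4 q')) = t * (2 * (g' (line 4 p) + g' (line 4 q'))) - 4 * u"
    using sub by (simp add: gg) (simp add: algebra_simps)
  also have "\<dots> = (\<Sum>c\<in>A 4. g c)"
    unfolding g'(2) unfolding sum4 using A4 by (simp add: gg) (simp add: algebra_simps)
  finally have "2 * (g (line 4 p) + g (line 4 q')) = 2 * (g (line 4 p) + g (line 4 q))" unfolding g(2) .
  then have "g (line 4 q') = g (line 4 q)" by simp
  moreover from this have "g d = g (line 4 p)" using g(2) unfolding sum4 by (simp add: algebra_simps)
  ultimately have g_vals: "g (line 4 q') = g (line 4 q)" "g d = g (line 4 p)" by blast+
  define h where "h = g (line 4 p) - g (line 4 q)"
  have "form 1 p = form 1 p - g (line 4 q) *s (\<Sum>c\<in>A 4. w c *s form_of c)" using w(2) by simp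
  also have "\<dots> = h *s (w (line 4 p) *s form 4 p + w d *s form_of d)"
    unfolding g(1) sum4 g_vals h_def by (simp add: vec_eq_iff algebra_simps)
  finally have f1: "form 1 p = h *s (w (line 4 p) *s form 4 p + w d *s form_of d)" .
  have "h \<noteq> 0" using f1 form_nonzero[of 1 "line 1 p"] line_in[of 1 p] p by auto
  moreover have "w d \<noteq> 0" using w(1) A4 by simp
  moreover have "ev (form 1 p) (vec_of p) = 0" "ev (form 4 p) (vec_of p) = 0"
    using ev_zero_iff[of 1 p] ev_zero_iff[of 4 p] p line_in[of 1 p] line_in[of 4 p] by simp_all
  ultimately have "ev (form_of d) (vec_of p) = 0" using f1 by simp
  then have "line 4 p = d" using ev_zero_iff[of 4 p d] p A4 by simp
  with d show False by simp
qed

end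

theorem mainTheorem1:
  shows "\<not> (\<exists>A X. is_kd_net 4 4 A X)"
proof
  assume "\<exists>A X. is_kd_net 4 4 A X"
  then obtain A X where "is_kd_net 4 4 A X" by blast
  then have "is_net 4 A X" "\<forall>i\<in>{1..4}. card (A i) = 4" "card X = 4\<^sup>2"
    by (simp_all add: is_kd_net_def)
  then interpret net_4_4 A X by unfold_locales auto
  show False by (rule no_net_4_4)
qed

end
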